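(* Let $n\ge 2$ be even and let $\sim$ be an equivalence relation on a finite set $A$ such that - $||\sim||=n$, and - $\mathrm{cost}(\sim)=\mathrm{cost}(n)$, so that $\sim$ has minimal total cost among all such equivalence relations. Then $\sim$ must have an equivalence class of size $\lfloor n\rfloor_{\diamondsuit}$, unless $n$ belongs to the set $\mathcal{X}=\{$24, 40, 50, 52, 86, 88, 120, 128, 174, 180, 198, 238, 266, 268, 296, 300, 378, 414, 534, 690, 740, 866, 922, 980, 982, 1188, 1254, 1256, 1692, 1962, 2136, 2344, 2438, 2440, 2632, 2966, 2968, 3180, 3780, 3870, 4530, 4662, 5384, 5528, 6312, 6468, 10280, 11550, 11762, 20574, 22950$\}$.
   Context: Let $\sim$ be an equivalence relation on a finite set whose equivalence classes have sizes $s_1,\dots,s_k$. Its total cost is $\mathrm{cost}(\sim)=\sum_{i=1}^k(s_i-1)$ (equivalently $\sum_{(x,x')}w(x,x')$, where $w(x,x')=1/s$ if $x\neq x'$ lie in a common class of size $s$, and $0$ otherwise). Its size is the number of equivalent ordered pairs of distinct elements, $||\sim||=\sum_{i=1}^k s_i(s_i-1)$. For an even natural number $n$, the minimum cost $\mathrm{cost}(n)$ is the minimum of $\mathrm{cost}(\sim)$ over all equivalence relations $\sim$ (on finite sets) of size $n$. The rhombic floor of $n$ is $\lfloor n\rfloor_{\diamondsuit}=\max\{t\in\mathbb{N}: t(t-1)\le n\}$. *)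

theory Defs
  imports Main
begin

definition total_cost :: "'a set \<Rightarrow> 'a rel \<Rightarrow> nat" where
  "total_cost A r = (\<Sum>C\<in>A // r. (card C - 1))"

(* The number of ordered pairs (x, y) in r with x \<noteq> y. For an equivalence relation on a
   finite set this equals the sum of s * (s - 1) over the class sizes s. *)
definition rel_size :: "'a rel \<Rightarrow> nat" where
  "rel_size r = card (r - Id)"

(* Every finite set is in bijection with a finite set of natural numbers, so letting the
   ground set range over finite subsets of nat covers equivalence relations on all finite
   sets. Every even n is attained (n div 2 classes of size 2), so for even n the minimum
   exists. *)
definition min_cost :: "nat \<Rightarrow> nat" where
  "min_cost n = (LEAST c. \<exists>(A :: nat set) r.
     finite A \<and> equiv A r \<and> rel_size r = n \<and> total_cost A r = c)"

definition rhombic_floor :: "nat \<Rightarrow> nat" where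
  "rhombic_floor n = Max {t. t * (t - 1) \<le> n}"

definition exceptional_sizes :: "nat set" where
  "exceptional_sizes = {24, 40, 50, 52, 86, 88, 120, 128, 174, 180, 198, 238, 266, 268,
     296, 300, 378, 414, 534, 690, 740, 866, 922, 980, 982, 1188, 1254, 1256, 1692, 1962,
     2136, 2344, 2438, 2440, 2632, 2966, 2968, 3180, 3780, 3870, 4530, 4662, 5384, 5528,
     6312, 6468, 10280, 11550, 11762, 20574, 22950}"

end

theory Submission
  imports Defs "HOL-Library.Multiset"
begin

text \<open>
  A class of size \<open>p + 1\<close> contributes \<open>p\<close> to the cost and \<open>p (p + 1)\<close>, twice the triangular number
  \<open>tri p\<close>, to the size. With \<open>n = 2 m\<close> the question is therefore how to write \<open>m\<close> as a sum of
  triangular numbers \<open>tri p\<close> with the least sum of the indices \<open>p\<close>; call this least sum \<open>cost m\<close>.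
  Write \<open>m = tri a + r\<close> with \<open>r \<le> a\<close>; the claim is that each optimal sum uses the index \<open>a\<close>,
  which corresponds to a class whose size is the rhombic floor.

  Taking \<open>tri a\<close> first shows \<open>cost m \<le> a + cost r\<close>. Suppose that the largest index of an optimal
  sum is \<open>b = a - k\<close> with \<open>k > 0\<close>. The remainder \<open>m - tri b\<close> has grown by about \<open>k a\<close>, and its
  cost can exceed \<open>cost r\<close> by at most \<open>k\<close>. Since a sum of indices \<open>c\<close> reaches at most \<open>tri c\<close>
  (\<open>le_tri_cost\<close>), this fails as long as \<open>k\<close> is not close to \<open>a\<close>: the condition obtained is
  quadratic and concave in \<open>k\<close>, so that it has to be checked at the ends of a range only. If \<open>k\<close> is
  close to \<open>a\<close>, all indices are small, so that many of them are needed (\<open>double_sum_tri_le\<close>).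
  The criterion \<open>forces_floor_part_criterion\<close> collects these conditions.

  The decisive one is \<open>k = 1\<close>, which asks for \<open>cost r + 1 < cost (a + r)\<close>. Since \<open>cost r\<close> is about
  \<open>sqrt (2 r)\<close> and \<open>cost (a + r)\<close> is at least about \<open>sqrt (4 r)\<close>, it holds for large \<open>r\<close>: the
  precise form is \<open>cost_bound\<close>, an induction along \<open>cost m \<le> t + cost r\<close> for \<open>m = tri t + r\<close>,
  whose base consists of the remainders up to \<open>150\<close>. For each smaller \<open>r\<close> it can fail for
  finitely many \<open>a\<close> only. These finitely many pairs, and all \<open>a < 15\<close>, are decided by a table of
  \<open>cost\<close> up to \<open>300\<close>, and every failure is one of the exceptional sizes.
\<close>

section \<open>Sums of triangular numbers\<close>

primrec tri :: "nat \<Rightarrow> nat" where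
  "tri 0 = 0"
| "tri (Suc n) = tri n + Suc n"

lemma double_tri: "2 * tri n = n * (n + 1)"
  by (induction n) auto

lemma tri_eq: "tri n = n * (n + 1) div 2"
  using double_tri[of n] by simp

lemma tri_superadditive: "tri p + tri q \<le> tri (p + q)"
  by (induction q) auto

lemma tri_mono: "p \<le> q \<Longrightarrow> tri p \<le> tri q"
  by (rule lift_Suc_mono_le) auto

lemma triangular_decomposition:
  obtains a r where "m = tri a + r" "r \<le> a"
proof (induction m arbitrary: thesis)
  case 0
  show ?case using 0[of 0 0] by simp
next
  case (Suc m)
  obtain a r where "m = tri a + r" "r \<le> a" using Suc.IH by blast
  then show ?case
    using Suc.prems[of a "Suc r"] Suc.prems[of "Suc a" 0] by (cases "r = a") auto
qed

text \<open>
  The least cost of a size, for multisets of class sizes decreased by one. Indices \<open>0\<close> are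
  permitted: they stand for singleton classes, which change neither cost nor size.
\<close>

definition cost :: "nat \<Rightarrow> nat" where
  "cost m = (LEAST c. \<exists>M. (\<Sum>p\<in>#M. tri p) = m \<and> \<Sum>\<^sub># M = c)"

lemma cost_attained:
  obtains M where "(\<Sum>p\<in>#M. tri p) = m" "\<Sum>\<^sub># M = cost m"
proof -
  have "\<exists>M. (\<Sum>p\<in>#M. tri p) = m \<and> \<Sum>\<^sub># M = m"
    by (rule exI[of _ "replicate_mset m 1"]) simp
  then have "\<exists>M. (\<Sum>p\<in>#M. tri p) = m \<and> \<Sum>\<^sub># M = cost m"
    unfolding cost_def by (rule LeastI)
  then show thesis using that by blast
qed

lemma cost_le: "(\<Sum>p\<in>#M. tri p) = m \<Longrightarrow> cost m \<le> \<Sum>\<^sub># M"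
  unfolding cost_def by (rule Least_le) blast

lemma cost_add_part: "cost (tri p + x) \<le> p + cost x"
proof -
  obtain M where "(\<Sum>p\<in>#M. tri p) = x" "\<Sum>\<^sub># M = cost x" by (rule cost_attained)
  then show ?thesis using cost_le[of "add_mset p M" "tri p + x"] by simp
qed

lemma cost_remove_part:
  assumes "(\<Sum>p\<in>#M. tri p) = m" "b \<in># M"
  shows "tri b \<le> m" "b + cost (m - tri b) \<le> \<Sum>\<^sub># M"
proof -
  obtain N where N: "M = add_mset b N" using assms(2) by (metis mset_add)
  show "tri b \<le> m" using assms(1) N by simp
  show "b + cost (m - tri b) \<le> \<Sum>\<^sub># M" using assms(1) N cost_le[of N "m - tri b"] by simp
qed

text \<open>
  Merging two indices \<open>p\<close> and \<open>q\<close> into \<open>p + q\<close> keeps the cost and does not decrease the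
  total, so a single index is the most that a given cost can reach.
\<close>

lemma le_tri_cost: "m \<le> tri (cost m)"
proof -
  have "(\<Sum>p\<in>#M. tri p) \<le> tri (\<Sum>\<^sub># M)" for M
  proof (induction M)
    case (add p M)
    then show ?case using tri_superadditive[of p "\<Sum>\<^sub># M"] by simp
  qed simp
  then show ?thesis using cost_attained by metis
qed

text \<open>
  An index \<open>p\<close> yields \<open>(p + 1) / 2\<close> per unit of cost, hence small indices are expensive.
\<close>

lemma double_sum_tri_le:
  "(\<And>p. p \<in># M \<Longrightarrow> p \<le> b) \<Longrightarrow> 2 * (\<Sum>p\<in>#M. tri p) \<le> \<Sum>\<^sub># M * (b + 1)"
proof (induction M)
  case (add p M)
  have "2 * tri p \<le> p * (b + 1)"
    using add.prems[of p] by (simp add: double_tri)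
  then show ?case using add by (simp add: algebra_simps)
qed simp

section \<open>From equivalence relations to multisets of class sizes\<close>

lemma rel_size_eq_sum:
  assumes "finite A" "equiv A r"
  shows "rel_size r = (\<Sum>C\<in>A // r. card C * (card C - 1))"
proof -
  have fin: "finite C" if "C \<in> A // r" for C
    using that assms by (meson finite_equiv_class equiv_type)
  have "r - Id = (\<Union>C\<in>A // r. C \<times> C - Id)"
  proof -
    have rel: "r = (\<Union>C\<in>A // r. C \<times> C)"
    proof (intro set_eqI iffI)
      fix z assume z: "z \<in> r"
      obtain x y where [simp]: "z = (x, y)" by (cases z)
      have "x \<in> A" "y \<in> A" using z assms(2) by (auto dest: equiv_type)
      then have "r `` {x} \<in> A // r" "x \<in> r `` {x}" "y \<in> r `` {x}"
        using z assms(2) by (auto intro: quotientI simp: equiv_def refl_on_def)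
      then show "z \<in> (\<Union>C\<in>A // r. C \<times> C)" by auto
    next
      fix z assume "z \<in> (\<Union>C\<in>A // r. C \<times> C)"
      then show "z \<in> r" using assms(2) by (auto dest: in_quotient_imp_in_rel)
    qed
    show ?thesis by (subst rel) blast
  qed
  moreover have "card (\<Union>C\<in>A // r. C \<times> C - Id) = (\<Sum>C\<in>A // r. card (C \<times> C - Id))"
  proof (rule card_UN_disjoint)
    show "finite (A // r)" using assms(1) equiv_type[OF assms(2)] by (rule finite_quotient)
    show "\<forall>C\<in>A // r. finite (C \<times> C - Id)" using fin by auto
    show "\<forall>C\<in>A // r. \<forall>D\<in>A // r. C \<noteq> D \<longrightarrow> (C \<times> C - Id) \<inter> (D \<times> D - Id) = {}"
    proof (intro ballI impI)
      fix C D assume "C \<in> A // r" "D \<in> A // r" "C \<noteq> D"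
      then have "C \<inter> D = {}" using quotient_disj[OF assms(2)] by blast
      then show "(C \<times> C - Id) \<inter> (D \<times> D - Id) = {}" by blast
    qed
  qed
  moreover have "card (C \<times> C - Id) = card C * (card C - 1)" if "finite C" for C :: "'a set"
  proof -
    have "C \<times> C - Id = C \<times> C - (\<lambda>x. (x, x)) ` C" by auto
    moreover have "card ((\<lambda>x. (x, x)) ` C) = card C" by (simp add: card_image inj_on_def)
    ultimately show ?thesis using that
      by (simp add: card_Diff_subset image_subset_iff card_cartesian_product right_diff_distrib')
  qed
  ultimately show ?thesis unfolding rel_size_def using fin by simp
qed

definition class_parts :: "'a set \<Rightarrow> 'a rel \<Rightarrow> nat multiset" where
  "class_parts A r = {#card C - 1. C \<in># mset_set (A // r)#}"

lemma sum_class_parts: "\<Sum>\<^sub># (class_parts A r) = total_cost A r"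
  by (simp add: class_parts_def total_cost_def sum_unfold_sum_mset)

lemma sum_tri_class_parts:
  assumes "finite A" "equiv A r"
  shows "2 * (\<Sum>p\<in>#class_parts A r. tri p) = rel_size r"
proof -
  have "2 * tri (card C - 1) = card C * (card C - 1)" for C :: "'a set"
    by (cases "card C") (simp_all add: double_tri del: tri.simps)
  then have "2 * (\<Sum>C\<in>A // r. tri (card C - 1)) = rel_size r"
    by (simp only: rel_size_eq_sum[OF assms] sum_distrib_left)
  then show ?thesis
    by (simp add: class_parts_def sum_unfold_sum_mset image_mset.compositionality comp_def)
qed

text \<open>
  Conversely every multiset of indices comes from a relation: each index \<open>p\<close> adds a block of
  \<open>p + 1\<close> fresh natural numbers as a new class.
\<close>

lemma parts_realised:
  "\<exists>(A :: nat set) r. finite A \<and> equiv A r \<and> rel_size r = 2 * (\<Sum>p\<in>#M. tri p)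
     \<and> total_cost A r = \<Sum>\<^sub># M"
proof (induction M)
  case empty
  show ?case
    by (rule exI[of _ "{}"], rule exI[of _ "{}"])
      (simp add: equiv_def refl_on_def sym_def trans_def rel_size_def total_cost_def)
next
  case (add p M)
  then obtain A :: "nat set" and r where A: "finite A" "equiv A r"
    and r: "rel_size r = 2 * (\<Sum>p\<in>#M. tri p)" "total_cost A r = \<Sum>\<^sub># M" by blast
  obtain N where N: "\<forall>x\<in>A. x < N" using A(1) finite_nat_set_iff_bounded by auto
  define B where "B = {N..N + p}"
  define s where "s = r \<union> B \<times> B"
  have disj: "A \<inter> B = {}" using N by (force simp: B_def)
  have B: "finite B" "card B = p + 1" "B \<noteq> {}" by (auto simp: B_def)
  have rA: "r \<subseteq> A \<times> A" using A(2) by (rule equiv_type)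
  have equiv: "equiv (A \<union> B) s"
  proof (rule equivI)
    show "s \<subseteq> (A \<union> B) \<times> (A \<union> B)" using rA by (auto simp: s_def)
    show "refl_on (A \<union> B) s" using A(2) by (auto simp: s_def equiv_def refl_on_def)
    show "sym s" using A(2) by (auto simp: s_def equiv_def sym_def)
    show "trans s" using A(2) rA disj unfolding s_def equiv_def trans_def by blast
  qed
  have quot: "(A \<union> B) // s = insert B (A // r)"
  proof -
    have "(\<lambda>x. s `` {x}) ` A = (\<lambda>x. r `` {x}) ` A"
      using disj by (intro image_cong) (auto simp: s_def)
    moreover have "(\<lambda>x. s `` {x}) ` B = (\<lambda>x. B) ` B"
      using disj rA by (intro image_cong) (auto simp: s_def)
    moreover have "D // q = (\<lambda>x. q `` {x}) ` D" for D and q :: "nat rel"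
      by (auto simp: quotient_def)
    ultimately show ?thesis using B(3) by (simp add: image_Un image_constant_conv)
  qed
  have new: "B \<notin> A // r"
    using B(3) disj in_quotient_imp_subset[OF A(2), of B] by blast
  have fin: "finite (A // r)" using A(1) rA by (rule finite_quotient)
  have "rel_size s = 2 * (\<Sum>p\<in>#add_mset p M. tri p)"
    using rel_size_eq_sum[OF _ equiv] rel_size_eq_sum[OF A] r(1) A(1) B fin new double_tri[of p]
    by (simp add: quot algebra_simps)
  moreover have "total_cost (A \<union> B) s = \<Sum>\<^sub># (add_mset p M)"
    using r(2) B fin new by (simp add: total_cost_def quot)
  ultimately show ?case using A(1) B(1) equiv by blast
qed

lemma min_cost_eq_cost: "min_cost (2 * m) = cost m"
proof -
  have eq: "(\<exists>(A :: nat set) r. finite A \<and> equiv A r \<and> rel_size r = 2 * m \<and> total_cost A r = c)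
      \<longleftrightarrow> (\<exists>M. (\<Sum>p\<in>#M. tri p) = m \<and> \<Sum>\<^sub># M = c)" for c
  proof
    assume "\<exists>(A :: nat set) r. finite A \<and> equiv A r \<and> rel_size r = 2 * m \<and> total_cost A r = c"
    then obtain A :: "nat set" and r
      where "finite A" "equiv A r" "rel_size r = 2 * m" "total_cost A r = c" by blast
    then have "(\<Sum>p\<in>#class_parts A r. tri p) = m" "\<Sum>\<^sub># (class_parts A r) = c"
      using sum_tri_class_parts[of A r] sum_class_parts[of A r] by auto
    then show "\<exists>M. (\<Sum>p\<in>#M. tri p) = m \<and> \<Sum>\<^sub># M = c" by blast
  next
    assume "\<exists>M. (\<Sum>p\<in>#M. tri p) = m \<and> \<Sum>\<^sub># M = c"
    then obtain M where "(\<Sum>p\<in>#M. tri p) = m" "\<Sum>\<^sub># M = c" by blast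
    then show "\<exists>(A :: nat set) r. finite A \<and> equiv A r \<and> rel_size r = 2 * m \<and> total_cost A r = c"
      using parts_realised[of M] by simp
  qed
  show ?thesis unfolding min_cost_def cost_def eq ..
qed

lemma rhombic_floor_eq:
  assumes "r \<le> a"
  shows "rhombic_floor (2 * (tri a + r)) = a + 1"
  unfolding rhombic_floor_def
proof (rule Max_eqI)
  have bound: "t \<le> a + 1" if "t * (t - 1) \<le> 2 * (tri a + r)" for t
  proof (rule ccontr)
    assume "\<not> t \<le> a + 1"
    then have "(a + 2) * (a + 1) \<le> t * (t - 1)" by (intro mult_le_mono) auto
    moreover have "(a + 2) * (a + 1) = 2 * tri a + 2 * a + 2"
      using double_tri[of a] by (simp add: algebra_simps)
    ultimately show False using that assms by simp
  qed
  then have "{t. t * (t - 1) \<le> 2 * (tri a + r)} \<subseteq> {..a + 1}" by blast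
  then show "finite {t. t * (t - 1) \<le> 2 * (tri a + r)}" by (rule finite_subset) simp
  show "t \<le> a + 1" if "t \<in> {t. t * (t - 1) \<le> 2 * (tri a + r)}" for t using that bound by blast
  show "a + 1 \<in> {t. t * (t - 1) \<le> 2 * (tri a + r)}" using double_tri[of a] by (simp add: algebra_simps)
qed

section \<open>A criterion for the presence of the largest possible class\<close>

text \<open>
  The claim for size \<open>2 (tri a + r)\<close> in terms of multisets. By \<open>rhombic_floor_eq\<close>, for
  \<open>r \<le> a\<close> the index \<open>a\<close> belongs to a class of size the rhombic floor.
\<close>

definition forces_floor_part :: "nat \<Rightarrow> nat \<Rightarrow> bool" where
  "forces_floor_part a r \<longleftrightarrow>
    (\<forall>M. (\<Sum>p\<in>#M. tri p) = tri a + r \<and> \<Sum>\<^sub># M = cost (tri a + r) \<longrightarrow> a \<in># M)"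

text \<open>
  No index exceeds \<open>a\<close>, because \<open>tri (a + 1)\<close> is too large. If \<open>a\<close> is absent, the largest
  index \<open>b\<close> is smaller, and the two consequences stated for \<open>b\<close> come from splitting off \<open>b\<close>
  and from the bound \<open>b\<close> on all indices.
\<close>

lemma forces_floor_partI:
  assumes "r \<le> a" "0 < a"
    and "\<And>b. 1 \<le> b \<Longrightarrow> b < a \<Longrightarrow> b + cost (tri a + r - tri b) \<le> cost (tri a + r)
      \<Longrightarrow> 2 * (tri a + r) \<le> cost (tri a + r) * (b + 1) \<Longrightarrow> False"
  shows "forces_floor_part a r"
  unfolding forces_floor_part_def
proof (intro allI impI)
  fix M assume M: "(\<Sum>p\<in>#M. tri p) = tri a + r \<and> \<Sum>\<^sub># M = cost (tri a + r)"
  show "a \<in># M"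
  proof (rule ccontr)
    assume "a \<notin># M"
    have small: "p < a" if "p \<in># M" for p
    proof -
      have "tri p \<le> tri a + r" using cost_remove_part(1)[of M] M that by blast
      then have "p < a + 1"
        using tri_mono[of "a + 1" p] assms(1) by fastforce
      then show ?thesis using that \<open>a \<notin># M\<close> by (cases "p = a") auto
    qed
    have "0 < a" by (rule assms(2))
    define b where "b = Max (insert 0 (set_mset M))"
    have max: "p \<le> b" if "p \<in># M" for p using that by (simp add: b_def)
    have lin: "2 * (tri a + r) \<le> cost (tri a + r) * (b + 1)"
      using double_sum_tri_le[of M b] max M by auto
    have "b \<in> insert 0 (set_mset M)" unfolding b_def by (rule Max_in) auto
    show False
    proof (cases "b = 0")
      case True
      then have "\<Sum>\<^sub># M = 0" using max by auto
      then have "tri a = 0" using lin M by auto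
      then show False using \<open>0 < a\<close> by (cases a) auto
    next
      case False
      then have "b \<in># M" using \<open>b \<in> insert 0 (set_mset M)\<close> by auto
      then show False
        using assms(3)[of b] small[of b] cost_remove_part(2)[of M _ b] M lin False by auto
    qed
  qed
qed

text \<open>
  Here \<open>k = a - b\<close> for the largest index \<open>b\<close> of a supposed counterexample. The premises
  \<open>drop1\<close> and \<open>drop2\<close> exclude \<open>k = 1\<close> and \<open>k = 2\<close>: then \<open>m - tri b\<close> is \<open>a + r\<close> and
  \<open>2 a - 1 + r\<close>. The premise \<open>middle\<close> excludes \<open>3 \<le> k \<le> a - C - 3\<close>, and \<open>tail\<close> all larger \<open>k\<close>.
  The cases \<open>1\<close> and \<open>2\<close> are kept apart because there the bound \<open>tri (cost x) \<ge> x\<close> is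
  sometimes too weak and has to be replaced by actual values of \<open>cost\<close>.
\<close>

lemma forces_floor_part_criterion:
  assumes "r \<le> a" "0 < a" and C: "cost r \<le> C"
    and drop1: "C + 1 < cost (a + r)"
    and drop2: "C + 2 < cost (2 * a - 1 + r)"
    and middle: "tri C + 3 * (C + 3) < r + 3 * a"
    and tail: "(a + C) * (C + 3) < a * (a + 1) + 2 * r"
  shows "forces_floor_part a r"
proof (rule forces_floor_partI[OF assms(1,2)])
  fix b assume b: "1 \<le> b" "b < a" and split: "b + cost (tri a + r - tri b) \<le> cost (tri a + r)"
    and few: "2 * (tri a + r) \<le> cost (tri a + r) * (b + 1)"
  have cost: "cost (tri a + r) \<le> a + C" using cost_add_part[of a r] C by simp
  obtain k where k: "a = b + k" "0 < k"
    using b(2) less_imp_add_positive[of b a] by auto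
  have rest: "cost (tri a + r - tri b) \<le> C + k" using split cost k by simp
  have "k = 1 \<or> k = 2 \<or> 3 \<le> k \<and> C + 3 + k \<le> a \<or> a < C + 3 + k"
    using k(2) by linarith
  then consider "k = 1" | "k = 2" | "3 \<le> k" "C + 3 + k \<le> a" | "a < C + 3 + k" by blast
  then show False
  proof cases
    case 1
    then have "tri a + r - tri b = a + r" using k by simp
    then show False using rest drop1 1 by simp
  next
    case 2
    then have "a = Suc (Suc b)" using k(1) by simp
    then have "tri a + r - tri b = 2 * a - 1 + r" by simp
    then show False using rest drop2 2 by simp
  next
    case 3
    \<comment> \<open>Half the difference of the two sides is \<open>k (a - C - k)\<close> plus a term free of \<open>k\<close>. For
      \<open>3 \<le> k \<le> a - C - 3\<close> it is smallest at the ends, where \<open>middle\<close> makes it positive;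
      \<open>j\<close> and \<open>d\<close> are the distances to the ends, and \<open>j d \<ge> 0\<close> closes the gap.\<close>
    obtain j where j: "k = 3 + j" using 3(1) le_Suc_ex by blast
    obtain d where d: "a = C + 3 + k + d" using 3(2) le_Suc_ex by blast
    have "tri a + r - tri b \<le> tri (C + k)"
      using le_tri_cost tri_mono[OF rest] by (rule order_trans)
    then have "2 * tri a + 2 * r \<le> 2 * tri b + 2 * tri (C + k)" by simp
    then have "a * (a + 1) + 2 * r \<le> b * (b + 1) + (C + k) * (C + k + 1)"
      by (simp only: double_tri)
    moreover have "b = C + 3 + d" using d k(1) by simp
    moreover have "C * (C + 1) + 6 * (C + 3) < 2 * r + 6 * a"
      using middle double_tri[of C] by linarith
    ultimately show False unfolding d j by (simp add: algebra_simps)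
  next
    case 4
    \<comment> \<open>All indices are at most \<open>C + 2\<close>, too small for the cost \<open>a + C\<close> to suffice.\<close>
    then have "b + 1 \<le> C + 3" using k(1) by simp
    with cost have "cost (tri a + r) * (b + 1) \<le> (a + C) * (C + 3)" by (rule mult_le_mono)
    then show False using few tail double_tri[of a] by simp
  qed
qed

section \<open>A table of least costs\<close>

text \<open>
  The values of \<open>cost\<close> from \<open>0\<close> to \<open>300\<close>. The largest one looked up is \<open>cost (a + r)\<close> for
  \<open>a = r = 150\<close>.
\<close>

definition cost_table :: "nat list" where
  "cost_table = [
    0, 1, 2, 2, 3, 4, 3, 4, 5, 5, 4, 5, 6, 6, 7, 5, 6, 7, 7, 8, 8, 6, 7, 8, 8, 9, 10, 9, 7,
    8, 9, 9, 10, 11, 10, 11, 8, 9, 10, 10, 11, 12, 11, 12, 13, 9, 10, 11, 11, 12, 13, 12,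
    13, 14, 14, 10, 11, 12, 12, 13, 14, 13, 14, 15, 15, 14, 11, 12, 13, 13, 14, 15, 14, 15,
    16, 16, 15, 16, 12, 13, 14, 14, 15, 16, 15, 16, 17, 17, 16, 17, 18, 13, 14, 15, 15, 16,
    17, 16, 17, 18, 18, 17, 18, 19, 19, 14, 15, 16, 16, 17, 18, 17, 18, 19, 19, 18, 19, 20,
    20, 20, 15, 16, 17, 17, 18, 19, 18, 19, 20, 20, 19, 20, 21, 21, 22, 20, 16, 17, 18, 18,
    19, 20, 19, 20, 21, 21, 20, 21, 22, 22, 23, 21, 22, 17, 18, 19, 19, 20, 21, 20, 21, 22,
    22, 21, 22, 23, 23, 24, 22, 23, 24, 18, 19, 20, 20, 21, 22, 21, 22, 23, 23, 22, 23, 24,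
    24, 25, 23, 24, 25, 25, 19, 20, 21, 21, 22, 23, 22, 23, 24, 24, 23, 24, 25, 25, 26, 24,
    25, 26, 26, 27, 20, 21, 22, 22, 23, 24, 23, 24, 25, 25, 24, 25, 26, 26, 27, 25, 26, 27,
    27, 28, 28, 21, 22, 23, 23, 24, 25, 24, 25, 26, 26, 25, 26, 27, 27, 28, 26, 27, 28, 28,
    29, 29, 27, 22, 23, 24, 24, 25, 26, 25, 26, 27, 27, 26, 27, 28, 28, 29, 27, 28, 29, 29,
    30, 30, 28, 29, 23, 24, 25, 25, 26, 27, 26, 27, 28, 28, 27, 28, 29, 29, 30, 28, 29, 30,
    30, 31, 31, 29, 30, 31, 24]"

lemma length_cost_table: "length cost_table = 301"
  by (simp add: cost_table_def)

lemma cost_table_entries: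
  assumes "cost_table = v # w # vs"
  shows "cost_table ! 0 = v \<and> cost_table ! Suc 0 = w \<and> map ((!) cost_table) [2..<301] = vs"
proof -
  have "map ((!) cost_table) [0..<301] = cost_table"
    using map_nth[of cost_table] by (simp only: length_cost_table)
  then have "drop 2 (map ((!) cost_table) [0..<301]) = drop 2 cost_table" by (rule arg_cong)
  then have "map ((!) cost_table) [2..<301] = drop 2 cost_table"
    by (simp only: drop_map drop_upt add_0)
  moreover have "drop 2 cost_table = vs" by (subst assms) simp
  moreover have "cost_table ! 0 = v" "cost_table ! Suc 0 = w" by (subst assms, simp)+
  ultimately show ?thesis by (simp only: simp_thms)
qed

text \<open>
  Conditional, in contrast to \<open>upt_rec_numeral\<close>: rewriting of an interval ends at its upper
  bound even if both branches of a conditional are rewritten.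
\<close>

lemma upt_numeral_Cons:
  "numeral k < (numeral l :: nat) \<Longrightarrow>
    [numeral k..<numeral l] = numeral k # [numeral (k + num.One)..<numeral l]"
  by (subst upt_rec) (simp add: Suc_numeral)

lemma upt_self: "[n..<n] = []"
  by simp

text \<open>
  The table as \<open>301\<close> separate equations. Used as rewrite rules, they make a lookup independent of
  the length of the list, which keeps the finite checks below fast.
\<close>

lemmas cost_table_values = cost_table_entries[OF cost_table_def, simplified upt_numeral_Cons
    upt_self numeral_less_iff rel_simps arith_simps list.map list.inject simp_thms]

lemmas enumerate_range =
  upt_rec_numeral upt_rec[of 0] upt_rec[of "Suc 0"] numeral_2_eq_2[symmetric]

text \<open>
  As congruence rules these two evaluate a disjunction or conjunction from left to right and skip
  the second part if the first one decides.
\<close>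

lemma disj_lazy: "P = P' \<Longrightarrow> (P \<or> Q) = (P' \<or> Q)"
  by simp

lemma conj_lazy: "P = P' \<Longrightarrow> (P \<and> Q) = (P' \<and> Q)"
  by simp

lemma list_all_bspec: "list_all P xs \<Longrightarrow> x \<in> set xs \<Longrightarrow> P x"
  by (simp add: list_all_iff)

text \<open>
  The two inequalities that make up the recursion \<open>cost x = Min {p + cost (x - tri p)}\<close>. As
  \<open>tri 25 > 300\<close>, indices below \<open>25\<close> are all that can occur in the lower bound. The upper bound
  covers the numbers up to \<open>150\<close>; trying large indices first finds a witness early.
\<close>

lemma table_lower_check:
  "list_all (\<lambda>p. list_all (\<lambda>(v, w). v \<le> p + w) (zip (drop (tri p) cost_table) cost_table))
     [1..<25]"
  by (simp add: cost_table_def tri_eq enumerate_range del: tri.simps)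

lemma table_upper_check:
  "list_all (\<lambda>x. list_ex (\<lambda>p. tri p \<le> x \<and> cost_table ! x = p + cost_table ! (x - tri p))
     (rev [1..<17])) [1..<151]"
  by (simp add: cost_table_values tri_eq enumerate_range del: tri.simps
      cong: disj_lazy conj_lazy)

lemma cost_table_le_add_part:
  assumes "0 < p" "tri p \<le> x" "x \<le> 300"
  shows "cost_table ! x \<le> p + cost_table ! (x - tri p)"
proof -
  have "p < 25"
  proof (rule ccontr)
    assume "\<not> p < 25"
    then have "tri 25 \<le> 300" using assms(2,3) tri_mono[of 25 p] by linarith
    then show False by (simp add: tri_eq)
  qed
  then have p: "p \<in> set [1..<25]" using assms(1) by simp
  have len: "x - tri p < length (zip (drop (tri p) cost_table) cost_table)"
    using assms by (simp add: length_cost_table)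
  have "zip (drop (tri p) cost_table) cost_table ! (x - tri p)
      = (cost_table ! x, cost_table ! (x - tri p))"
    using assms by (simp add: length_cost_table)
  then show ?thesis
    using list_all_bspec[OF list_all_bspec[OF table_lower_check p] nth_mem[OF len]] by simp
qed

lemma cost_table_le_cost: "x \<le> 300 \<Longrightarrow> cost_table ! x \<le> cost x"
proof (induction x rule: less_induct)
  case (less x)
  obtain M where M: "(\<Sum>p\<in>#M. tri p) = x" "\<Sum>\<^sub># M = cost x" by (rule cost_attained)
  show ?case
  proof (cases "x = 0")
    case True
    then show ?thesis by (simp add: cost_table_def)
  next
    case False
    then obtain p where p: "p \<in># M" "tri p \<noteq> 0"
      using sum_mset_0_iff[of "image_mset tri M"] unfolding M(1) by auto
    then have "0 < p" by (cases p) auto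
    note remove = cost_remove_part[OF M(1) p(1)]
    have "cost_table ! x \<le> p + cost_table ! (x - tri p)"
      using \<open>0 < p\<close> remove(1) less.prems by (rule cost_table_le_add_part)
    also have "\<dots> \<le> p + cost (x - tri p)"
      using less.IH[of "x - tri p"] less.prems p(2) False by simp
    also have "\<dots> \<le> cost x" using remove(2) M(2) by simp
    finally show ?thesis .
  qed
qed

lemma cost_le_cost_table: "x \<le> 150 \<Longrightarrow> cost x \<le> cost_table ! x"
proof (induction x rule: less_induct)
  case (less x)
  show ?case
  proof (cases "x = 0")
    case True
    then show ?thesis using cost_le[of "{#}" 0] by simp
  next
    case False
    then have "x \<in> set [1..<151]" using less.prems by simp
    then obtain p where p: "p \<in> set (rev [1..<17])" "tri p \<le> x"
      "cost_table ! x = p + cost_table ! (x - tri p)"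
      using list_all_bspec[OF table_upper_check] unfolding list_ex_iff by blast
    have "0 < p" using p(1) by simp
    then have "0 < tri p" by (cases p) auto
    have "cost x \<le> p + cost (x - tri p)" using cost_add_part[of p "x - tri p"] p(2) by simp
    also have "\<dots> \<le> cost_table ! x"
      using less.IH[of "x - tri p"] less.prems False \<open>0 < tri p\<close> p(3) by simp
    finally show ?thesis .
  qed
qed

section \<open>The growth of the least cost\<close>

text \<open>
  The base of the induction in \<open>cost_bound\<close> for the numbers \<open>tri t + r\<close> above \<open>150\<close> with
  \<open>r \<le> 150\<close>. Since \<open>tri 16 = 136\<close>, these have \<open>t \<ge> 16\<close>, and \<open>t \<ge> 17\<close> if \<open>r < 15\<close>; besides
  \<open>t \<ge> r\<close>. Only the least such \<open>t\<close> is tested, because of \<open>cost_bound_step\<close>.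
\<close>

lemma table_growth_check:
  "list_all (\<lambda>r. let C = cost_table ! r; s = max (if r < 15 then 17 else 16) r in
       C < s \<and> (s + C + 1) * (s + C + 2) < 4 * (tri s + r)) [0..<151]"
  by (simp add: cost_table_values tri_eq enumerate_range Let_def del: tri.simps)

text \<open>
  The left side grows with \<open>t\<close> like \<open>t\<^sup>2\<close>, the right side like \<open>2 t\<^sup>2\<close>.
\<close>

lemma cost_bound_step:
  fixes c s t :: nat
  assumes "s \<le> t" "c < s" "(s + c + 1) * (s + c + 2) < 4 * (tri s + r)"
  shows "(t + c + 1) * (t + c + 2) < 4 * (tri t + r)"
proof -
  obtain d where d: "t = s + d" using assms(1) le_Suc_ex by blast
  have "c * d + d \<le> s * d" using mult_le_mono1[of "c + 1" s d] assms(2) by (simp add: algebra_simps)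
  moreover have "4 * tri s = 2 * (s * (s + 1))" "4 * tri t = 2 * (t * (t + 1))"
    using double_tri[of s] double_tri[of t] by linarith+
  ultimately show ?thesis using assms(3) unfolding d by (simp add: algebra_simps)
qed

text \<open>
  The true order of \<open>cost m\<close> is \<open>sqrt (2 m)\<close>. The weaker bound here, about \<open>2 sqrt m\<close>, is
  \<open>tri (cost m + 1) < 2 m\<close> in disguise, the form in which \<open>drop1\<close> asks for it. For \<open>m = tri t + r\<close>
  with large \<open>r\<close> the induction hypothesis and \<open>r \<le> t\<close> imply \<open>cost r < t / 2\<close>, and this absorbs
  the mixed term of the product for \<open>t + cost r\<close>, while the hypothesis itself absorbs the rest.
\<close>

lemma cost_bound: "150 < m \<Longrightarrow> (cost m + 1) * (cost m + 2) < 4 * m"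
proof (induction m rule: less_induct)
  case (less m)
  obtain t r where m: "m = tri t + r" and r: "r \<le> t" by (rule triangular_decomposition)
  have le: "cost m \<le> t + cost r" using cost_add_part m by simp
  have "16 \<le> t"
    using less.prems m r tri_mono[of t 15] tri_eq[of 15] by (cases "16 \<le> t") auto
  have "(t + cost r + 1) * (t + cost r + 2) < 4 * m"
  proof (cases "r \<le> 150")
    case True
    define s where "s = max (if r < 15 then 17 else 16) r"
    let ?C = "cost_table ! r"
    have s: "?C < s" "(s + ?C + 1) * (s + ?C + 2) < 4 * (tri s + r)"
      using list_all_bspec[OF table_growth_check, of r] True
      by (simp_all only: s_def Let_def set_upt atLeastLessThan_iff) auto
    have "r < 15 \<Longrightarrow> t \<noteq> 16" using less.prems m tri_eq[of 16] by auto
    then have "s \<le> t" using \<open>16 \<le> t\<close> r by (auto simp: s_def)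
    then have "(t + ?C + 1) * (t + ?C + 2) < 4 * m"
      unfolding m using s by (rule cost_bound_step)
    moreover have "(t + cost r + 1) * (t + cost r + 2) \<le> (t + ?C + 1) * (t + ?C + 2)"
      using cost_le_cost_table[OF True] by (intro mult_le_mono) auto
    ultimately show ?thesis by linarith
  next
    case False
    have "0 < tri t" using \<open>16 \<le> t\<close> by (cases t) auto
    then have IH: "(cost r + 1) * (cost r + 2) < 4 * r" using less.IH[of r] m False by simp
    have "2 * cost r + 1 \<le> t"
    proof (rule ccontr)
      assume "\<not> 2 * cost r + 1 \<le> t"
      then have "t * t \<le> (2 * cost r) * (2 * cost r)" by (intro mult_le_mono) auto
      also have "\<dots> \<le> 4 * ((cost r + 1) * (cost r + 2))" by (simp add: algebra_simps)
      also have "\<dots> < 16 * t" using IH r by linarith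
      finally have "t < 16" by simp
      then show False using \<open>16 \<le> t\<close> by simp
    qed
    then have "(2 * cost r + 1) * t \<le> t * t" by (rule mult_le_mono1)
    moreover have "4 * tri t = 2 * (t * (t + 1))" using double_tri[of t] by linarith
    ultimately show ?thesis using IH m by (simp add: algebra_simps)
  qed
  moreover have "(cost m + 1) * (cost m + 2) \<le> (t + cost r + 1) * (t + cost r + 2)"
    using le by (intro mult_le_mono) auto
  ultimately show ?case by linarith
qed

section \<open>Large and small remainders\<close>

text \<open>
  The bound on \<open>cost r\<close> gives \<open>tri (cost r + 1) < 2 r \<le> a + r\<close>, hence \<open>drop1\<close>. It also shows that
  \<open>cost r\<close> is at most of the order of \<open>sqrt a\<close>, which leaves ample room in the other premises.
\<close>

lemma forces_floor_part_large_remainder: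
  assumes "r \<le> a" "150 < r"
  shows "forces_floor_part a r"
proof (rule forces_floor_part_criterion)
  let ?C = "cost r"
  have bound: "(?C + 1) * (?C + 2) < 4 * r" using assms(2) by (rule cost_bound)
  have far: "?C + 5 \<le> a"
  proof (rule ccontr)
    assume "\<not> ?C + 5 \<le> a"
    then have "(a - 3) * (a - 2) \<le> (?C + 1) * (?C + 2)" by (intro mult_le_mono) auto
    moreover obtain d where "a = 151 + d" using assms le_Suc_ex[of 151 a] by auto
    ultimately show False using bound assms(1) by (simp add: algebra_simps)
  qed
  have tri1: "tri (?C + 1) < a + r" using bound double_tri[of "?C + 1"] assms(1) by simp
  show "?C + 1 < cost (a + r)"
    using le_tri_cost[of "a + r"] tri1 tri_mono[of "cost (a + r)" "?C + 1"] by linarith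
  have "tri (?C + 2) < 2 * a - 1 + r" using tri1 far by simp
  then show "?C + 2 < cost (2 * a - 1 + r)"
    using le_tri_cost[of "2 * a - 1 + r"] tri_mono[of "cost (2 * a - 1 + r)" "?C + 2"] by linarith
  show "tri ?C + 3 * (?C + 3) < r + 3 * a" using tri1 far by simp
  obtain d where d: "a = ?C + 5 + d" using far le_Suc_ex by blast
  have "?C * (?C + 3) + 2 < 4 * r" using bound by (simp add: algebra_simps)
  moreover have "a * (a + 1) = a * (?C + 3) + (d + 3) * a" by (subst (2) d) (simp add: algebra_simps)
  ultimately show "(a + ?C) * (?C + 3) < a * (a + 1) + 2 * r"
    using assms by (simp add: algebra_simps)
qed (use assms in auto)

text \<open>
  For \<open>r \<le> 150\<close> the premises \<open>middle\<close> and \<open>tail\<close> of the criterion are monotone in \<open>a\<close> and tested at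
  the least \<open>a\<close> in question. The start \<open>15\<close> is forced: \<open>middle\<close> fails for \<open>a = r = 14\<close>.
  The conjunct \<open>C + 3 \<le> s\<close> is what makes \<open>tail\<close> monotone, and together with
  \<open>tri (C + 1) < a + r\<close> it gives \<open>drop2\<close>.
\<close>

lemma table_margin_check:
  "list_all (\<lambda>r. let C = cost_table ! r; s = max 15 r in
       C + 3 \<le> s \<and> tri C + 3 * (C + 3) < r + 3 * s \<and> (s + C) * (C + 3) < s * (s + 1) + 2 * r)
     [0..<151]"
  by (simp add: cost_table_values tri_eq enumerate_range Let_def del: tri.simps)

text \<open>
  If \<open>a\<close> lies beyond the interval considered here, then \<open>tri (C + 1) < a + r\<close>, and \<open>drop1\<close> and
  \<open>drop2\<close> follow without the table.
\<close>

lemma table_neighbour_check: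
  "list_all (\<lambda>r. let C = cost_table ! r in list_all (\<lambda>a.
       a + r \<le> 300 \<and> C + 1 < cost_table ! (a + r) \<and>
       (tri (C + 2) < 2 * a - 1 + r \<or> 2 * a - 1 + r \<le> 300 \<and> C + 2 < cost_table ! (2 * a - 1 + r)) \<or>
       a * (a + 1) + 2 * r \<in> exceptional_sizes)
     [max 15 r..<tri (C + 1) + 1 - r]) [0..<151]"
  by (simp add: cost_table_values tri_eq enumerate_range exceptional_sizes_def Let_def
      del: tri.simps cong: disj_lazy)

lemma forces_floor_part_small_remainder:
  assumes "r \<le> a" "r \<le> 150" "15 \<le> a" "2 * (tri a + r) \<notin> exceptional_sizes"
  shows "forces_floor_part a r"
proof (rule forces_floor_part_criterion)
  define C where "C = cost_table ! r"
  define s where "s = max 15 r"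
  have s: "C + 3 \<le> s" "tri C + 3 * (C + 3) < r + 3 * s" "(s + C) * (C + 3) < s * (s + 1) + 2 * r"
    using list_all_bspec[OF table_margin_check, of r] assms(2)
    by (simp_all only: s_def C_def Let_def set_upt atLeastLessThan_iff) auto
  obtain d where d: "a = s + d" using assms(1,3) le_Suc_ex[of s a] by (auto simp: s_def)
  show "cost r \<le> C" unfolding C_def using assms(2) by (rule cost_le_cost_table)
  show "tri C + 3 * (C + 3) < r + 3 * a" using s(2) d by simp
  have "d * (C + 3) \<le> d * s" using s(1) by (rule mult_le_mono2)
  then show "(a + C) * (C + 3) < a * (a + 1) + 2 * r"
    using s(3) unfolding d by (simp add: algebra_simps)
  have "C + 1 < cost (a + r) \<and> C + 2 < cost (2 * a - 1 + r)"
  proof (cases "tri (C + 1) < a + r")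
    case True
    moreover from this have "tri (C + 2) < 2 * a - 1 + r"
      using s(1) d by simp
    ultimately show ?thesis
      using le_tri_cost[of "a + r"] tri_mono[of "cost (a + r)" "C + 1"]
        le_tri_cost[of "2 * a - 1 + r"] tri_mono[of "cost (2 * a - 1 + r)" "C + 2"] by linarith
  next
    case False
    then have "a \<in> set [max 15 r..<tri (C + 1) + 1 - r]" using assms(1,3) by auto
    moreover have "a * (a + 1) + 2 * r \<notin> exceptional_sizes"
      using assms(4) by (simp only: distrib_left double_tri not_False_eq_True)
    moreover have "r \<in> set [0..<151]" using assms(2) by simp
    ultimately have "a + r \<le> 300" "C + 1 < cost_table ! (a + r)"
      "tri (C + 2) < 2 * a - 1 + r \<or> 2 * a - 1 + r \<le> 300 \<and> C + 2 < cost_table ! (2 * a - 1 + r)"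
      using list_all_bspec[OF list_all_bspec[OF table_neighbour_check, unfolded Let_def], of r a]
      unfolding C_def by blast+
    then show ?thesis
      using cost_table_le_cost[of "a + r"] cost_table_le_cost[of "2 * a - 1 + r"]
        le_tri_cost[of "2 * a - 1 + r"] tri_mono[of "cost (2 * a - 1 + r)" "C + 2"] by linarith
  qed
  then show "C + 1 < cost (a + r)" "C + 2 < cost (2 * a - 1 + r)" by auto
qed (use assms in auto)

text \<open>
  For \<open>a < 15\<close> each candidate \<open>b\<close> for the largest index is excluded separately: either splitting
  off \<open>b\<close> is already too expensive, or the bound \<open>b\<close> on all indices is.
\<close>

lemma table_small_check:
  "list_all (\<lambda>a. list_all (\<lambda>r.
       list_all (\<lambda>b. cost_table ! (tri a + r) < b + cost_table ! (tri a + r - tri b) \<or>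
          cost_table ! (tri a + r) * (b + 1) < a * (a + 1) + 2 * r) [1..<a]
      \<or> a * (a + 1) + 2 * r \<in> exceptional_sizes)
     [0..<a + 1]) [1..<15]"
  by (simp add: cost_table_values tri_eq enumerate_range exceptional_sizes_def
      del: tri.simps cong: disj_lazy)

lemma forces_floor_part_small:
  assumes "r \<le> a" "0 < a" "a < 15" "2 * (tri a + r) \<notin> exceptional_sizes"
  shows "forces_floor_part a r"
proof (rule forces_floor_partI[OF assms(1,2)])
  let ?m = "tri a + r"
  fix b assume b: "1 \<le> b" "b < a" "b + cost (?m - tri b) \<le> cost ?m"
    "2 * ?m \<le> cost ?m * (b + 1)"
  have double: "2 * ?m = a * (a + 1) + 2 * r" by (simp only: distrib_left double_tri)
  have "?m \<le> 150" using assms(1,3) tri_mono[of a 14] tri_eq[of 14] by simp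
  then have cost: "cost ?m = cost_table ! ?m" "cost (?m - tri b) \<ge> cost_table ! (?m - tri b)"
    using cost_table_le_cost cost_le_cost_table by (auto intro: antisym)
  have "a \<in> set [1..<15]" "r \<in> set [0..<a + 1]" "b \<in> set [1..<a]" using assms b by auto
  then have "cost_table ! ?m < b + cost_table ! (?m - tri b) \<or>
      cost_table ! ?m * (b + 1) < a * (a + 1) + 2 * r"
    using list_all_bspec[OF list_all_bspec[OF table_small_check], of a r] assms(4)
      list_all_bspec[of _ "[1..<a]" b] unfolding double by blast
  then show False using b(3,4) cost(2) unfolding cost(1) double by linarith
qed

section \<open>The class of size the rhombic floor\<close>

theorem theorem9:
  fixes n :: nat and A :: "'a set" and r :: "'a rel"
  assumes "n \<ge> 2" and "even n"
    and "finite A" and "equiv A r"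
    and "rel_size r = n"
    and "total_cost A r = min_cost n"
    and "n \<notin> exceptional_sizes"
  shows "\<exists>C \<in> A // r. card C = rhombic_floor n"
proof -
  obtain m where m: "n = 2 * m" using assms(2) by (rule evenE)
  obtain a q where q: "m = tri a + q" "q \<le> a" by (rule triangular_decomposition)
  have "0 < a" using assms(1) m q by (cases a) auto
  have "forces_floor_part a q"
    using forces_floor_part_small forces_floor_part_small_remainder forces_floor_part_large_remainder
      q \<open>0 < a\<close> assms(7) m by (metis not_le)
  moreover have "(\<Sum>p\<in>#class_parts A r. tri p) = m"
    using sum_tri_class_parts[OF assms(3,4)] assms(5) m by simp
  moreover have "\<Sum>\<^sub># (class_parts A r) = cost m"
    using sum_class_parts[of A r] assms(6) m min_cost_eq_cost by simp
  ultimately have "a \<in># class_parts A r" using q(1) by (simp add: forces_floor_part_def)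
  moreover have "finite (A // r)" using assms(3) equiv_type[OF assms(4)] by (rule finite_quotient)
  ultimately obtain C where "C \<in> A // r" "a = card C - 1" by (auto simp: class_parts_def)
  then show ?thesis using \<open>0 < a\<close> rhombic_floor_eq[OF q(2)] m q(1) by (intro bexI[of _ C]) auto
qed

end
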